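(* Let $F$ be a field, let $\lambda\in F$ with $\lambda\neq 0$ be such that the polynomial $X^{2}+\lambda$ has no root in $F$, let $L=\mathrm{Lei}_{4}(3,F)$ be the Leibniz algebra with parameter $\lambda$ defined in the context, and let $G=\mathrm{Aut}_{[,]}(L)$ be its automorphism group. (1) If $\mathrm{char}(F)=2$, then $G$ is isomorphic to the subgroup of $\mathrm{GL}_{3}(F)$ which consists of the (invertible) matrices of the form $$\begin{pmatrix}\alpha_{1} & \lambda\alpha_{2} & 0\\ \alpha_{2} & \alpha_{1} & 0\\ \alpha_{3} & \beta_{3} & \alpha_{1}^{2}+\lambda\alpha_{2}^{2}\end{pmatrix},\qquad \alpha_{1},\alpha_{2},\alpha_{3},\beta_{3}\in F.$$ Furthermore, $C=C_{G}(L/\zeta(L))$ is a normal subgroup of $G$, $C$ is isomorphic to the direct product of two copies of the additive group of $F$, and $G/C$ is isomorphic to the subgroup of $\mathrm{GL}_{2}(F)$ which consists of the (invertible) matrices of the form $$\begin{pmatrix}\alpha_{1} & \lambda\alpha_{2}\\ \alpha_{2} & \alpha_{1}\end{pmatrix},\qquad \alpha_{1},\alpha_{2}\in F.$$ (2) If $\mathrm{char}(F)\neq 2$, then $G$ is isomorphic to the subgroup of $\mathrm{GL}_{3}(F)$ which consists of the (invertible) matrices of the form $$\begin{pmatrix}\alpha_{1} & \delta\lambda\alpha_{2} & 0\\ \alpha_{2} & -\delta\alpha_{1} & 0\\ \alpha_{3} & \beta_{3} & \alpha_{1}^{2}+\lambda\alpha_{2}^{2}\end{pmatrix},\qquad \alpha_{1},\alpha_{2},\alpha_{3},\beta_{3}\in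 F,\ \delta\in\{-1,1\}.$$ Furthermore, $C=C_{G}(L/\zeta(L))$ is a normal subgroup of $G$, $C$ is isomorphic to the direct product of two copies of the additive group of $F$, and $G/C$ is isomorphic to the subgroup of $\mathrm{GL}_{2}(F)$ which consists of the (invertible) matrices of the form $$\begin{pmatrix}\alpha_{1} & \delta\lambda\alpha_{2}\\ \alpha_{2} & -\delta\alpha_{1}\end{pmatrix},\qquad \alpha_{1},\alpha_{2}\in F,\ \delta\in\{-1,1\}.$$
   Context: A (left) Leibniz algebra over a field $F$ is an $F$-vector space $L$ with a bilinear operation $[,]$ satisfying $[[a,b],c]=[a,[b,c]]-[b,[a,c]]$ for all $a,b,c\in L$. An automorphism of $L$ is a bijective linear map $f:L\to L$ with $f([a,b])=[f(a),f(b)]$ for all $a,b\in L$; the automorphisms form a group $\mathrm{Aut}_{[,]}(L)$ under composition. For $0\neq\lambda\in F$, the Leibniz algebra $\mathrm{Lei}_{4}(3,F)$ is the 3-dimensional $F$-vector space $Fa_{1}\oplus Fa_{2}\oplus Fa_{3}$ with basis $a_1,a_2,a_3$ and with $[a_{1},a_{1}]=a_{3}$, $[a_{2},a_{2}]=\lambda a_{3}$, and all other products $[a_i,a_j]$ of basis elements equal to $0$. The center of $L$ is $\zeta(L)=\{x\in L\mid [x,y]=0=[y,x]\text{ for every }y\in L\}$; it is an ideal of $L$, and for $L=\mathrm{Lei}_{4}(3,F)$ it equals $Fa_{3}$. For an ideal $A$ of $L$ and $G=\mathrm{Aut}_{[,]}(L)$, put $C_{G}(L/A)=\{\alpha\in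 G\mid \alpha(x)\in x+A\text{ for every }x\in L\}$. *)

theory Defs
  imports "HOL-Analysis.Determinants" "HOL-Algebra.Coset"
    "HOL-Computational_Algebra.Polynomial"
begin

section \<open>Left Leibniz algebras\<close>

locale leibniz_algebra = vector_space smul
  for smul :: "'f::field \<Rightarrow> 'v::ab_group_add \<Rightarrow> 'v" +
  fixes bracket :: "'v \<Rightarrow> 'v \<Rightarrow> 'v"
  assumes bracket_linear_right: "Vector_Spaces.linear smul smul (\<lambda>y. bracket x y)"
    and bracket_linear_left: "Vector_Spaces.linear smul smul (\<lambda>x. bracket x y)"
    and leibniz: "bracket (bracket a b) c = bracket a (bracket b c) - bracket b (bracket a c)"

definition leibniz_automorphism ::
    "('f::field \<Rightarrow> 'v::ab_group_add \<Rightarrow> 'v) \<Rightarrow> ('v \<Rightarrow> 'v \<Rightarrow> 'v) \<Rightarrow> ('v \<Rightarrow> 'v) \<Rightarrow> bool" where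
  "leibniz_automorphism smul bracket f \<longleftrightarrow>
     bij f \<and> Vector_Spaces.linear smul smul f \<and>
     (\<forall>a b. f (bracket a b) = bracket (f a) (f b))"

definition aut_group ::
    "('f::field \<Rightarrow> 'v::ab_group_add \<Rightarrow> 'v) \<Rightarrow> ('v \<Rightarrow> 'v \<Rightarrow> 'v) \<Rightarrow> ('v \<Rightarrow> 'v) monoid" where
  "aut_group smul bracket =
     \<lparr>carrier = {f. leibniz_automorphism smul bracket f}, mult = (\<circ>), one = id\<rparr>"

definition leibniz_center :: "('v::ab_group_add \<Rightarrow> 'v \<Rightarrow> 'v) \<Rightarrow> 'v set" where
  "leibniz_center bracket = {x. \<forall>y. bracket x y = 0 \<and> bracket y x = 0}"

text \<open>The set \<open>C\<^sub>G(L/A)\<close>; it is only of interest when \<open>A\<close> is an ideal of \<open>L\<close>, as the center is.\<close>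

definition quotient_centralizer ::
    "('v::ab_group_add \<Rightarrow> 'v) monoid \<Rightarrow> 'v set \<Rightarrow> ('v \<Rightarrow> 'v) set" where
  "quotient_centralizer G A = {f \<in> carrier G. \<forall>x. f x \<in> (+) x ` A}"


section \<open>The algebra \<open>Lei\<^sub>4(3,F)\<close>\<close>

text \<open>The underlying space is \<open>F\<^sup>3\<close>, with \<open>a\<^sub>i\<close> the \<open>i\<close>-th standard basis vector \<open>axis i 1\<close>. The bracket
  is the bilinear extension of the table of products of basis vectors.\<close>

definition lei4_basis_bracket :: "'f::field \<Rightarrow> 3 \<Rightarrow> 3 \<Rightarrow> 'f^3" where
  "lei4_basis_bracket l i j =
     (if i = 1 \<and> j = 1 then axis 3 1
      else if i = 2 \<and> j = 2 then l *s axis 3 1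
      else 0)"

definition lei4_bracket :: "'f::field \<Rightarrow> 'f^3 \<Rightarrow> 'f^3 \<Rightarrow> 'f^3" where
  "lei4_bracket l x y = (\<Sum>i\<in>UNIV. \<Sum>j\<in>UNIV. (x $ i * y $ j) *s lei4_basis_bracket l i j)"

lemma lei4_bracket_axis: "lei4_bracket l (axis i 1) (axis j 1) = lei4_basis_bracket l i j"
proof -
  have "lei4_bracket l (axis i 1) (axis j 1) =
      (\<Sum>i'\<in>UNIV. \<Sum>j'\<in>UNIV. if i' = i then if j' = j then lei4_basis_bracket l i j else 0 else 0)"
    unfolding lei4_bracket_def by (intro sum.cong refl) (auto simp: axis_def)
  also have "\<dots> = (\<Sum>i'\<in>UNIV. if i' = i then lei4_basis_bracket l i j else 0)"
    by (intro sum.cong refl) simp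
  finally show ?thesis by simp
qed

lemma lei4_bracket_eq:
  "lei4_bracket l x y = (x $ 1 * y $ 1 + l * (x $ 2 * y $ 2)) *s axis 3 1"
  by (simp add: lei4_bracket_def lei4_basis_bracket_def sum_3 vec_eq_iff axis_def algebra_simps)

lemma leibniz_algebra_lei4: "leibniz_algebra (*s) (lei4_bracket l)"
proof -
  have ax: "(axis 3 1 :: 'a^3) $ 1 = 0" "(axis 3 1 :: 'a^3) $ 2 = 0" by (simp_all add: axis_def)
  show ?thesis
    by unfold_locales (simp_all add: lei4_bracket_eq ax vec_eq_iff algebra_simps)
qed

lemma leibniz_center_lei4:
  assumes "l \<noteq> 0"
  shows "leibniz_center (lei4_bracket l) = range (\<lambda>c. c *s axis 3 1)"
proof (intro equalityI subsetI)
  fix x assume "x \<in> leibniz_center (lei4_bracket l)"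
  hence *: "lei4_bracket l x y $ 3 = 0" for y by (simp add: leibniz_center_def)
  have "x $ 1 = 0" "x $ 2 = 0"
    using *[of "axis 1 1"] *[of "axis 2 1"] assms by (simp_all add: lei4_bracket_eq axis_def)
  hence "x = x $ 3 *s axis 3 1" by (simp add: vec_eq_iff forall_3 axis_def)
  thus "x \<in> range (\<lambda>c. c *s axis 3 1)" by blast
next
  fix x assume "x \<in> range (\<lambda>c. c *s (axis 3 1 :: 'a^3))"
  thus "x \<in> leibniz_center (lei4_bracket l)"
    by (auto simp: leibniz_center_def lei4_bracket_eq axis_def vec_eq_iff)
qed


section \<open>Groups of matrices and of scalars\<close>

definition GL_group :: "('f::field^'n^'n) monoid" where
  "GL_group = \<lparr>carrier = {A. invertible A}, mult = (**), one = mat 1\<rparr>"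

definition additive_group :: "'f::field monoid" where
  "additive_group = \<lparr>carrier = UNIV, mult = (+), one = 0\<rparr>"

text \<open>Matrices are written as the vector of their rows.\<close>

definition mats3_char2 :: "'f::field \<Rightarrow> ('f^3^3) set" where
  "mats3_char2 l = {A. invertible A \<and> (\<exists>\<alpha>1 \<alpha>2 \<alpha>3 \<beta>3.
     A = vector [vector [\<alpha>1, l * \<alpha>2, 0],
                 vector [\<alpha>2, \<alpha>1,     0],
                 vector [\<alpha>3, \<beta>3,     \<alpha>1^2 + l * \<alpha>2^2]])}"

definition mats2_char2 :: "'f::field \<Rightarrow> ('f^2^2) set" where
  "mats2_char2 l = {A. invertible A \<and> (\<exists>\<alpha>1 \<alpha>2.
     A = vector [vector [\<alpha>1, l * \<alpha>2],
                 vector [\<alpha>2, \<alpha>1]])}"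

definition mats3 :: "'f::field \<Rightarrow> ('f^3^3) set" where
  "mats3 l = {A. invertible A \<and> (\<exists>\<alpha>1 \<alpha>2 \<alpha>3 \<beta>3. \<exists>\<delta>\<in>{-1, 1}.
     A = vector [vector [\<alpha>1, \<delta> * l * \<alpha>2, 0],
                 vector [\<alpha>2, - \<delta> * \<alpha>1,    0],
                 vector [\<alpha>3, \<beta>3,         \<alpha>1^2 + l * \<alpha>2^2]])}"

definition mats2 :: "'f::field \<Rightarrow> ('f^2^2) set" where
  "mats2 l = {A. invertible A \<and> (\<exists>\<alpha>1 \<alpha>2. \<exists>\<delta>\<in>{-1, 1}.
     A = vector [vector [\<alpha>1, \<delta> * l * \<alpha>2],
                 vector [\<alpha>2, - \<delta> * \<alpha>1]])}"

end

theory Submission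
  imports Defs
begin

text \<open>Writing an automorphism as the matrix of its values on \<open>a\<^sub>1, a\<^sub>2, a\<^sub>3\<close> makes it a similitude of the
  anisotropic form \<open>x\<^sup>2 + \<lambda> y\<^sup>2\<close> on \<open>L/\<zeta>(L)\<close>, extended by an arbitrary linear map
  \<open>L/\<zeta>(L) \<rightarrow> \<zeta>(L)\<close>; on the center it is multiplication by the similitude factor. Taking
  the upper left block is a homomorphism with kernel \<open>C\<close>. The two cases of the theorem are one:
  in characteristic 2 the sign \<open>\<delta>\<close> disappears.\<close>

section \<open>Groups of matrices and automorphisms, and images of homomorphisms\<close>

lemma group_GL_group: "group (GL_group :: ('f::field^'n^'n) monoid)"
proof (rule groupI)
  fix A :: "'f^'n^'n"
  assume "A \<in> carrier GL_group"
  then obtain B where "A ** B = mat 1" "B ** A = mat 1"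
    by (auto simp: GL_group_def invertible_def)
  then show "\<exists>B\<in>carrier GL_group. B \<otimes>\<^bsub>GL_group\<^esub> A = \<one>\<^bsub>GL_group\<^esub>"
    by (auto simp: GL_group_def invertible_def)
qed (simp_all add: GL_group_def invertible_mult matrix_mul_assoc,
    auto simp: invertible_def intro: exI[of _ "mat 1"])

text \<open>Each identity for the inverse is checked after applying the injective map
  \<open>f\<close>, where it follows from the same identity for \<open>f\<close>.\<close>

lemma leibniz_automorphism_inv:
  assumes "vector_space smul" and f: "leibniz_automorphism smul bracket f"
  shows "leibniz_automorphism smul bracket (inv_into UNIV f)"
proof -
  interpret vector_space smul by fact
  interpret vector_space_pair smul smul ..
  have bij: "bij f" and lin: "Vector_Spaces.linear smul smul f"
    and br: "f (bracket a b) = bracket (f a) (f b)" for a b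
    using f by (auto simp: leibniz_automorphism_def)
  have ff: "f (inv_into UNIV f x) = x" for x
    using bij by (simp add: bij_is_surj surj_f_inv_f)
  have inj: "x = y" if "f x = f y" for x y
    using that bij by (metis bij_is_inj injD)
  have "Vector_Spaces.linear smul smul (inv_into UNIV f)"
    by (unfold_locales; rule inj) (simp_all add: ff linear_add[OF lin] linear_scale[OF lin])
  moreover have "inv_into UNIV f (bracket a b) = bracket (inv_into UNIV f a) (inv_into UNIV f b)" for a b
    by (rule inj) (simp add: ff br)
  ultimately show ?thesis
    by (simp add: leibniz_automorphism_def bij_imp_bij_inv[OF bij])
qed

lemma group_aut_group:
  assumes "vector_space smul"
  shows "group (aut_group smul bracket)"
proof (rule groupI)
  interpret vector_space smul by fact
  show "\<one>\<^bsub>aut_group smul bracket\<^esub> \<in> carrier (aut_group smul bracket)"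
    by (simp add: aut_group_def leibniz_automorphism_def linear_id)
  fix f g
  assume "f \<in> carrier (aut_group smul bracket)" "g \<in> carrier (aut_group smul bracket)"
  then show "f \<otimes>\<^bsub>aut_group smul bracket\<^esub> g \<in> carrier (aut_group smul bracket)"
    by (auto simp: aut_group_def leibniz_automorphism_def
        intro: bij_comp Vector_Spaces.linear_compose)
next
  fix f
  assume "f \<in> carrier (aut_group smul bracket)"
  then have "leibniz_automorphism smul bracket (inv_into UNIV f)" and "inj f"
    using leibniz_automorphism_inv[OF assms]
    by (auto simp: aut_group_def leibniz_automorphism_def bij_is_inj)
  then show "\<exists>g\<in>carrier (aut_group smul bracket).
      g \<otimes>\<^bsub>aut_group smul bracket\<^esub> f = \<one>\<^bsub>aut_group smul bracket\<^esub>"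
    by (auto simp: aut_group_def intro!: bexI[of _ "inv_into UNIV f"])
qed (auto simp: aut_group_def)

lemma aut_group_carrier_iff:
  "f \<in> carrier (aut_group smul bracket) \<longleftrightarrow> leibniz_automorphism smul bracket f"
  by (simp add: aut_group_def)

text \<open>The first isomorphism theorem for an image known explicitly as a set; shrinking the
  codomain to \<open>K\<close> leaves the kernel unchanged. It serves both for \<open>matrix\<close>
  and for its upper left block.\<close>

lemma group_hom_onto_subgroup:
  assumes "group_hom G H h" and "h ` carrier G = K"
  shows "subgroup K H" and "group_hom G (H\<lparr>carrier := K\<rparr>) h"
    and "G Mod kernel G H h \<cong> H\<lparr>carrier := K\<rparr>"
proof -
  interpret group_hom G H h by fact
  show K: "subgroup K H" using img_is_subgroup assms(2) by simp
  show K': "group_hom G (H\<lparr>carrier := K\<rparr>) h"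
    using K homh assms(2) H.subgroup_imp_group
    by (auto simp: group_hom_def group_hom_axioms_def hom_def)
  have "kernel G (H\<lparr>carrier := K\<rparr>) h = kernel G H h" by (simp add: kernel_def)
  then show "G Mod kernel G H h \<cong> H\<lparr>carrier := K\<rparr>"
    using group_hom.FactGroup_iso[OF K'] assms(2) by simp
qed

section \<open>Matrices that preserve the bracket\<close>

lemma matrix_eq_3:
  fixes A :: "'a::zero^3^3"
  shows "A = vector [vector [a, b, c], vector [d, e, f], vector [g, h, i]] \<longleftrightarrow>
    A$1$1 = a \<and> A$1$2 = b \<and> A$1$3 = c \<and> A$2$1 = d \<and> A$2$2 = e \<and> A$2$3 = f \<and>
    A$3$1 = g \<and> A$3$2 = h \<and> A$3$3 = i"
  by (auto simp: vec_eq_iff forall_3 vector_3)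

lemma matrix_eq_2:
  fixes A :: "'a::zero^2^2"
  shows "A = vector [vector [a, b], vector [c, d]] \<longleftrightarrow>
    A$1$1 = a \<and> A$1$2 = b \<and> A$2$1 = c \<and> A$2$2 = d"
  by (auto simp: vec_eq_iff forall_2 vector_2)

text \<open>Three products of basis vectors give all the conditions. From [a1,a1] = a3 the third
  column is (0, 0, N) with N the norm of column 1 under x^2 + l y^2; [a1,a2] = 0 makes columns 1 and
  2 orthogonal; [a2,a2] = l a3 gives column 2 the norm l N. Conversely, these conditions yield the
  identity for all vectors by expansion in coordinates.\<close>

lemma lei4_preserved_iff:
  fixes A :: "'f::field^3^3"
  shows "(\<forall>x y. A *v lei4_bracket l x y = lei4_bracket l (A *v x) (A *v y)) \<longleftrightarrow>
    A$1$3 = 0 \<and> A$2$3 = 0 \<and> A$3$3 = (A$1$1)^2 + l * (A$2$1)^2 \<and>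
    A$1$1 * A$1$2 + l * (A$2$1 * A$2$2) = 0 \<and>
    l * A$3$3 = (A$1$2)^2 + l * (A$2$2)^2" (is "?L \<longleftrightarrow> ?R")
proof
  assume L: ?L
  have "A *v lei4_bracket l (axis i 1) (axis j 1) =
      lei4_bracket l (A *v axis i 1) (A *v axis j 1)" for i j
    using L by blast
  note this[of 1 1] this[of 1 2] this[of 2 2]
  then show ?R
    by (simp add: vec_eq_iff forall_3 lei4_bracket_eq matrix_vector_mult_def sum_3 axis_def
        power2_eq_square algebra_simps)
next
  assume R: ?R
  then have "A *v lei4_bracket l x y = lei4_bracket l (A *v x) (A *v y)" for x y
    by (simp add: vec_eq_iff forall_3 lei4_bracket_eq matrix_vector_mult_def sum_3 axis_def) algebra
  then show ?L by blast
qed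

text \<open>The columns \<open>(a, b)\<close> and \<open>(c, d)\<close> are orthogonal for the anisotropic form
  \<open>x\<^sup>2 + l y\<^sup>2\<close>, so \<open>(c, d)\<close> is a multiple of \<open>(l b, - a)\<close>; comparing norms, the
  factor squares to 1.\<close>

lemma orthogonal_column_iff:
  fixes l :: "'f::field"
  assumes l: "l \<noteq> 0" and N: "a^2 + l * b^2 \<noteq> 0"
  shows "a * c + l * (b * d) = 0 \<and> l * (a^2 + l * b^2) = c^2 + l * d^2 \<longleftrightarrow>
    (\<exists>\<delta>\<in>{-1, 1}. c = \<delta> * l * b \<and> d = - \<delta> * a)" (is "?L \<longleftrightarrow> ?R")
proof
  assume L: ?L
  \<comment> \<open>The only possible factor: c = s l b and d = -s a would give b c - a d = s (a^2 +
    l b^2).\<close>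
  define s where "s = (b * c - a * d) / (a^2 + l * b^2)"
  have sN: "s * (a^2 + l * b^2) = b * c - a * d" using N by (simp add: s_def)
  have "(a^2 + l * b^2) * c = (a^2 + l * b^2) * (s * l * b)"
    using L sN by algebra
  with N have c: "c = s * l * b" by simp
  have "(a^2 + l * b^2) * d = (a^2 + l * b^2) * (- s * a)"
    using L sN by algebra
  with N have d: "d = - s * a" by (metis mult_left_cancel)
  have "(l * (a^2 + l * b^2)) * s^2 = (l * (a^2 + l * b^2)) * 1"
    using L unfolding c d by algebra
  then have "s^2 = 1" using N l by simp
  then have "s \<in> {-1, 1}" by (auto simp: power2_eq_1_iff)
  with c d show ?R by blast
next
  assume ?R
  then show ?L by (auto simp: power2_eq_square algebra_simps)
qed

text \<open>A zero with b nonzero would make a / b a root of X^2 + l. This is where the absence of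
  roots enters.\<close>

lemma anisotropic:
  fixes l :: "'f::field"
  assumes "\<not> (\<exists>x. poly (monom 1 2 + [:l:]) x = 0)"
  shows "a^2 + l * b^2 = 0 \<longleftrightarrow> a = 0 \<and> b = 0"
proof
  assume ab: "a^2 + l * b^2 = 0"
  have "b = 0"
  proof (rule ccontr)
    assume "b \<noteq> 0"
    then have "poly (monom 1 2 + [:l:]) (a / b) = 0"
      using ab by (simp add: poly_monom field_simps)
    with assms show False by blast
  qed
  with ab show "a = 0 \<and> b = 0" by simp
qed simp

text \<open>If the first column has nonzero norm, \<open>orthogonal_column_iff\<close> parametrises
  the second. If the norm is zero, anisotropy kills the top two entries of the first column; as the
  third column also vanishes there, the determinant is zero and neither side holds.\<close>

lemma mats3_iff:
  fixes l :: "'f::field"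
  assumes l: "l \<noteq> 0" and root: "\<not> (\<exists>x. poly (monom 1 2 + [:l:]) x = 0)"
  shows "A \<in> mats3 l \<longleftrightarrow> invertible A \<and>
    (\<forall>x y. A *v lei4_bracket l x y = lei4_bracket l (A *v x) (A *v y))"
proof (cases "(A$1$1)^2 + l * (A$2$1)^2 = 0")
  case True
  then have "A$1$1 = 0" "A$2$1 = 0" using anisotropic[OF root] by auto
  then have "\<not> invertible A" if "A$1$3 = 0" "A$2$3 = 0"
    using that by (simp add: invertible_det_nz det_3)
  then show ?thesis by (auto simp: lei4_preserved_iff mats3_def vector_3)
next
  case False
  show ?thesis
    using orthogonal_column_iff[OF l False, of "A$1$2" "A$2$2"]
    unfolding lei4_preserved_iff mats3_def matrix_eq_3 by auto
qed

text \<open>Linearity remains a separate condition because \<open>matrix f\<close> records only the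
  values of \<open>f\<close> on the basis.\<close>

lemma lei4_automorphism_iff:
  fixes l :: "'f::field"
  assumes "l \<noteq> 0" and "\<not> (\<exists>x. poly (monom 1 2 + [:l:]) x = 0)"
  shows "leibniz_automorphism (*s) (lei4_bracket l) f \<longleftrightarrow>
    Vector_Spaces.linear (*s) (*s) f \<and> matrix f \<in> mats3 l"
proof -
  have "bij f \<longleftrightarrow> invertible (matrix f)" if "Vector_Spaces.linear (*s) (*s) f"
    using invertible_eq_bij[of "matrix f"] matrix_works[OF that] by (simp cong: bij_betw_cong)
  then show ?thesis
    by (auto simp: leibniz_automorphism_def mats3_iff[OF assms] matrix_works)
qed

section \<open>The upper left block\<close>

definition upper_block :: "'a::zero^3^3 \<Rightarrow> 'a^2^2" where
  "upper_block A = vector [vector [A$1$1, A$1$2], vector [A$2$1, A$2$2]]"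

lemma mats3_column_3: "A \<in> mats3 l \<Longrightarrow> A$1$3 = 0 \<and> A$2$3 = 0"
  by (auto simp: mats3_def vector_3)

text \<open>The matrices are block lower triangular, so the summand with index 3 drops out of every
  entry of the upper block of the product.\<close>

lemma upper_block_mult:
  assumes "B$1$3 = 0" "B$2$3 = 0" "A$1$3 = 0" "A$2$3 = 0"
  shows "upper_block (A ** B) = upper_block A ** upper_block B"
  using assms
  by (simp add: upper_block_def vec_eq_iff forall_2 vector_2 matrix_matrix_mult_def sum_2 sum_3)

lemma invertible_upper_block:
  fixes A :: "'f::field^3^3"
  assumes "A$1$3 = 0" "A$2$3 = 0" "invertible A"
  shows "invertible (upper_block A)"
proof -
  have "det A = A$3$3 * det (upper_block A)"
    using assms by (simp add: det_3 det_2 upper_block_def vector_2 algebra_simps)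
  with assms show ?thesis by (auto simp: invertible_det_nz)
qed

lemma upper_block_image: "upper_block ` mats3 l = mats2 (l :: 'f::field)"
proof (intro equalityI subsetI)
  fix B assume "B \<in> upper_block ` mats3 l"
  then obtain A where A: "A \<in> mats3 l" and B: "B = upper_block A" by blast
  have "invertible B"
    unfolding B using A mats3_column_3[OF A] by (intro invertible_upper_block) (auto simp: mats3_def)
  then show "B \<in> mats2 l"
    using A unfolding B mats2_def mats3_def upper_block_def by (auto simp: vector_3) blast+
next
  fix B assume "B \<in> mats2 l"
  then obtain a b \<delta> where B: "invertible B" "\<delta> \<in> {-1, 1}"
    "B = vector [vector [a, \<delta> * l * b], vector [b, - \<delta> * a]]"
    unfolding mats2_def by blast
  \<comment> \<open>The simplest lift: the free entries of the third row are 0, and the corner is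
    forced to be the similitude factor.\<close>
  define A where "A = (vector [vector [a, \<delta> * l * b, 0], vector [b, - \<delta> * a, 0],
    vector [0, 0, a^2 + l * b^2]] :: 'f^3^3)"
  \<comment> \<open>Up to sign, the corner of the lift is the determinant of \<open>B\<close>, so
    invertibility of \<open>B\<close> makes it nonzero.\<close>
  have "det B = - \<delta> * (a^2 + l * b^2)"
    by (simp add: B(3) det_2 vector_2 power2_eq_square algebra_simps)
  then have "a^2 + l * b^2 \<noteq> 0" using B(1) by (auto simp: invertible_det_nz)
  moreover have "det A = (a^2 + l * b^2) * det B"
    by (simp add: A_def B(3) det_3 det_2 vector_2 vector_3 algebra_simps)
  ultimately have "invertible A" using B(1) by (simp add: invertible_det_nz)
  then have "A \<in> mats3 l" using B(2) unfolding mats3_def A_def by blast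
  moreover have "B = upper_block A"
    by (simp add: B(3) A_def upper_block_def vector_3)
  ultimately show "B \<in> upper_block ` mats3 l" by blast
qed

section \<open>The automorphism group G and the centralizer C of L/zeta(L)\<close>

context
  fixes l :: "'f::field" and G C
  assumes l: "l \<noteq> 0" and root: "\<not> (\<exists>x. poly (monom 1 2 + [:l:]) x = 0)"
  defines "G \<equiv> aut_group (*s) (lei4_bracket l)"
  defines "C \<equiv> quotient_centralizer G (leibniz_center (lei4_bracket l))"
begin

lemma carrier_G: "f \<in> carrier G \<longleftrightarrow> Vector_Spaces.linear (*s) (*s) f \<and> matrix f \<in> mats3 l"
  by (simp add: G_def aut_group_carrier_iff lei4_automorphism_iff[OF l root])

lemma matrix_mult_G:
  assumes "f \<in> carrier G" "g \<in> carrier G"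
  shows "matrix (f \<otimes>\<^bsub>G\<^esub> g) = matrix f ** matrix g"
  using assms matrix_compose_gen[of g f] by (simp add: carrier_G, simp add: G_def aut_group_def)

lemma group_G: "group G"
  unfolding G_def by (intro group_aut_group) unfold_locales

lemma matrix_image_G: "matrix ` carrier G = mats3 l"
proof (intro equalityI subsetI)
  fix A assume "A \<in> mats3 l"
  then have "(*v) A \<in> carrier G" by (simp add: carrier_G)
  then show "A \<in> matrix ` carrier G" by (rule rev_image_eqI) simp
qed (auto simp: carrier_G)

lemma group_hom_matrix: "group_hom G GL_group matrix"
proof -
  have "matrix \<in> hom G GL_group"
    by (rule homI) (auto simp: matrix_mult_G, auto simp: carrier_G GL_group_def mats3_def)
  then show ?thesis
    by (simp add: group_hom_def group_hom_axioms_def group_G group_GL_group)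
qed

text \<open>This map is the induced action on L/zeta(L), written in the basis of the images of a1
  and a2; hence its kernel will be C.\<close>

lemma group_hom_upper_block: "group_hom G GL_group (upper_block \<circ> matrix)"
proof -
  have "upper_block \<circ> matrix \<in> hom G GL_group"
  proof (rule homI)
    fix f assume "f \<in> carrier G"
    then have A: "matrix f \<in> mats3 l" by (simp add: carrier_G)
    show "(upper_block \<circ> matrix) f \<in> carrier GL_group"
      using A mats3_column_3[OF A] by (auto simp: GL_group_def mats3_def intro: invertible_upper_block)
  next
    fix f g assume fg: "f \<in> carrier G" "g \<in> carrier G"
    then have "matrix f \<in> mats3 l" "matrix g \<in> mats3 l" by (simp_all add: carrier_G)
    then show "(upper_block \<circ> matrix) (f \<otimes>\<^bsub>G\<^esub> g) =
        (upper_block \<circ> matrix) f \<otimes>\<^bsub>GL_group\<^esub> (upper_block \<circ> matrix) g"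
      using mats3_column_3 by (auto simp: GL_group_def matrix_mult_G[OF fg] intro!: upper_block_mult)
  qed
  then show ?thesis
    by (simp add: group_hom_def group_hom_axioms_def group_G group_GL_group)
qed

lemma G_iso: "G \<cong> GL_group\<lparr>carrier := mats3 l\<rparr>"
proof -
  interpret h: group_hom G "GL_group\<lparr>carrier := mats3 l\<rparr>" matrix
    by (rule group_hom_onto_subgroup(2)[OF group_hom_matrix matrix_image_G])
  have "inj_on matrix (carrier G)"
  proof (rule inj_onI)
    fix f g assume "f \<in> carrier G" "g \<in> carrier G" "matrix f = matrix g"
    then show "f = g" by (metis carrier_G ext matrix_works)
  qed
  then have "matrix \<in> iso G (GL_group\<lparr>carrier := mats3 l\<rparr>)"
    by (intro isoI h.homh) (simp add: bij_betw_def matrix_image_G)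
  then show ?thesis by (rule is_isoI)
qed

text \<open>The center consists of the vectors whose first two coordinates vanish. So an
  automorphism acts trivially modulo the center iff it keeps the first two coordinates of every
  vector, that is, iff its upper block is the identity.\<close>

lemma C_iff:
  "f \<in> C \<longleftrightarrow> Vector_Spaces.linear (*s) (*s) f \<and> (\<exists>a b. matrix f =
    vector [vector [1, 0, 0], vector [0, 1, 0], vector [a, b, 1]])" (is "_ \<longleftrightarrow> ?R")
  and C_kernel: "C = kernel G GL_group (upper_block \<circ> matrix)"
proof -
  \<comment> \<open>These unipotent matrices always preserve the bracket, so the description of C
    need not mention membership in G.\<close>
  have mats: "A \<in> mats3 l"
    if "A = vector [vector [1, 0, 0], vector [0, 1, 0], vector [a, b, 1]]" for A a b
  proof -
    have "det A = 1" by (simp add: that det_3 vector_3)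
    then have "invertible A" by (simp add: invertible_det_nz)
    then show ?thesis
      by (simp add: mats3_iff[OF l root] lei4_preserved_iff that vector_3)
  qed
  \<comment> \<open>An identity block means \<alpha>1 = 1 and \<alpha>2 = 0, which forces the corner
    \<alpha>1^2 + l \<alpha>2^2 to be 1.\<close>
  have block: "upper_block A = mat 1 \<longleftrightarrow>
      (\<exists>a b. A = vector [vector [1, 0, 0], vector [0, 1, 0], vector [a, b, 1]])"
    if "A \<in> mats3 l" for A
    using that unfolding mats3_def
    by (auto simp: upper_block_def vec_eq_iff forall_2 forall_3 vector_2 vector_3 mat_def)
  have ker: "f \<in> kernel G GL_group (upper_block \<circ> matrix) \<longleftrightarrow>
    Vector_Spaces.linear (*s) (*s) f \<and> (\<exists>a b. matrix f =
    vector [vector [1, 0, 0], vector [0, 1, 0], vector [a, b, 1]])" for f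
    by (simp add: kernel_def carrier_G GL_group_def) (use mats block in blast)
  have "f \<in> C \<longleftrightarrow> f \<in> kernel G GL_group (upper_block \<circ> matrix)" for f
  proof (cases "f \<in> carrier G")
    case f: True
    then have lin: "f x = matrix f *v x" for x by (simp add: carrier_G matrix_works)
    have A: "matrix f \<in> mats3 l" using f by (simp add: carrier_G)
    have center: "z \<in> leibniz_center (lei4_bracket l) \<longleftrightarrow> z$1 = 0 \<and> z$2 = 0" for z
      unfolding leibniz_center_lei4[OF l]
      by (auto simp: axis_def vec_eq_iff forall_3 intro!: image_eqI[of _ _ "z$3"])
    have "f x \<in> (+) x ` leibniz_center (lei4_bracket l) \<longleftrightarrow> f x $ 1 = x $ 1 \<and> f x $ 2 = x $ 2" for x
      by (auto simp: center intro!: image_eqI[of _ _ "f x - x"])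
    then have "f \<in> C \<longleftrightarrow> (\<forall>x. f x $ 1 = x $ 1 \<and> f x $ 2 = x $ 2)"
      using f by (simp add: C_def quotient_centralizer_def)
    also have "\<dots> \<longleftrightarrow> upper_block (matrix f) = mat 1"
    proof
      assume L: "\<forall>x. f x $ 1 = x $ 1 \<and> f x $ 2 = x $ 2"
      show "upper_block (matrix f) = mat 1"
        using L by (simp add: upper_block_def matrix_def vec_eq_iff forall_2 vector_2 mat_def axis_def)
    next
      assume "upper_block (matrix f) = mat 1"
      with mats3_column_3[OF A] show "\<forall>x. f x $ 1 = x $ 1 \<and> f x $ 2 = x $ 2"
        by (simp add: lin matrix_vector_mult_def sum_3 upper_block_def vec_eq_iff forall_2 vector_2 mat_def)
    qed
    finally show ?thesis using f by (simp add: kernel_def GL_group_def)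
  qed (auto simp: C_def quotient_centralizer_def kernel_def)
  then show "C = kernel G GL_group (upper_block \<circ> matrix)" by blast
  with ker show "f \<in> C \<longleftrightarrow> ?R" by blast
qed

lemma C_normal: "C \<lhd> G"
  unfolding C_kernel by (rule group_hom.normal_kernel[OF group_hom_upper_block])

text \<open>Multiplying two matrices of the form in \<open>C_iff\<close> adds their free entries (a,
  b). Reading off these entries is therefore a homomorphism, and it is bijective since they are
  arbitrary and determine the linear map.\<close>

lemma C_iso: "G\<lparr>carrier := C\<rparr> \<cong> (additive_group :: 'f monoid) \<times>\<times> (additive_group :: 'f monoid)"
proof -
  define h where "h f = (matrix f $ 3 $ 1, matrix f $ 3 $ 2)" for f :: "'f^3 \<Rightarrow> 'f^3"
  have C_carrier: "f \<in> carrier G" if "f \<in> C" for f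
    using that by (simp add: C_def quotient_centralizer_def)
  have "h \<in> hom (G\<lparr>carrier := C\<rparr>) (additive_group \<times>\<times> additive_group)"
  proof (rule homI)
    fix f g assume "f \<in> carrier (G\<lparr>carrier := C\<rparr>)" "g \<in> carrier (G\<lparr>carrier := C\<rparr>)"
    then have fg: "f \<in> C" "g \<in> C" by simp_all
    then obtain a b c d where
      "matrix f = vector [vector [1, 0, 0], vector [0, 1, 0], vector [a, b, 1]]"
      "matrix g = vector [vector [1, 0, 0], vector [0, 1, 0], vector [c, d, 1]]"
      by (auto simp: C_iff)
    with matrix_mult_G[OF fg[THEN C_carrier]]
    show "h (f \<otimes>\<^bsub>G\<lparr>carrier := C\<rparr>\<^esub> g) = h f \<otimes>\<^bsub>additive_group \<times>\<times> additive_group\<^esub> h g"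
      by (simp add: h_def additive_group_def DirProd_def matrix_matrix_mult_def sum_3 vector_3)
  qed (simp add: additive_group_def)
  moreover have "bij_betw h C UNIV"
    unfolding bij_betw_def
  proof
    show "inj_on h C"
    proof (rule inj_onI)
      fix f g assume fg: "f \<in> C" "g \<in> C" "h f = h g"
      then have "matrix f = matrix g"
        by (auto simp: C_iff h_def vector_3)
      with fg show "f = g" by (metis C_iff ext matrix_works)
    qed
    have "(a, b) \<in> h ` C" for a b
    proof
      let ?A = "vector [vector [1, 0, 0], vector [0, 1, 0], vector [a, b, 1]] :: 'f^3^3"
      show "(*v) ?A \<in> C" unfolding C_iff by auto
      show "(a, b) = h ((*v) ?A)" by (simp add: h_def vector_3)
    qed
    then show "h ` C = UNIV" by auto
  qed
  ultimately have "h \<in> iso (G\<lparr>carrier := C\<rparr>) (additive_group \<times>\<times> additive_group)"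
    by (intro isoI) (simp_all add: additive_group_def)
  then show ?thesis by (rule is_isoI)
qed

lemma upper_block_image_G: "(upper_block \<circ> matrix) ` carrier G = mats2 l"
  by (simp only: image_comp[symmetric] matrix_image_G upper_block_image)

lemma aut_lei4_structure:
  "subgroup (mats3 l) GL_group \<and> G \<cong> GL_group\<lparr>carrier := mats3 l\<rparr> \<and> C \<lhd> G \<and>
   G\<lparr>carrier := C\<rparr> \<cong> (additive_group :: 'f monoid) \<times>\<times> (additive_group :: 'f monoid) \<and>
   subgroup (mats2 l) GL_group \<and> G Mod C \<cong> GL_group\<lparr>carrier := mats2 l\<rparr>"
  using group_hom_onto_subgroup(1)[OF group_hom_matrix matrix_image_G] G_iso C_normal C_iso
    group_hom_onto_subgroup(1,3)[OF group_hom_upper_block upper_block_image_G]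
  by (simp add: C_kernel)

end

section \<open>Characteristic 2 and the final statement\<close>

lemma mats_char2:
  fixes l :: "'f::field"
  assumes "CHAR('f) = 2"
  shows "mats3_char2 l = mats3 l" and "mats2_char2 l = mats2 l"
proof -
  have "(1 + 1 :: 'f) = 0" using of_nat_CHAR[where 'a = 'f] assms by simp
  then have "(1 :: 'f) = -1" by (simp add: eq_neg_iff_add_eq_0)
  \<comment> \<open>As a rewrite rule this collapses {-1, 1} to {1} and removes the sign from the
    second column.\<close>
  then have neg: "- x = x" for x :: 'f by (metis mult_1 mult_minus_left)
  show "mats3_char2 l = mats3 l" "mats2_char2 l = mats2 l"
    by (simp_all add: mats3_char2_def mats3_def mats2_char2_def mats2_def neg)
qed

theorem theorem3p7:
  fixes l :: "'f::field"
  assumes "l \<noteq> 0"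
    and "\<not> (\<exists>x. poly (monom 1 2 + [:l:]) x = 0)"
  defines "G \<equiv> aut_group (*s) (lei4_bracket l)"
  defines "C \<equiv> quotient_centralizer G (leibniz_center (lei4_bracket l))"
  shows "(CHAR('f) = 2 \<longrightarrow>
            subgroup (mats3_char2 l) GL_group \<and>
            G \<cong> GL_group\<lparr>carrier := mats3_char2 l\<rparr> \<and>
            C \<lhd> G \<and>
            G\<lparr>carrier := C\<rparr> \<cong> (additive_group :: 'f monoid) \<times>\<times> (additive_group :: 'f monoid) \<and>
            subgroup (mats2_char2 l) GL_group \<and>
            G Mod C \<cong> GL_group\<lparr>carrier := mats2_char2 l\<rparr>) \<and>
         (CHAR('f) \<noteq> 2 \<longrightarrow>
            subgroup (mats3 l) GL_group \<and>
            G \<cong> GL_group\<lparr>carrier := mats3 l\<rparr> \<and>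
            C \<lhd> G \<and>
            G\<lparr>carrier := C\<rparr> \<cong> (additive_group :: 'f monoid) \<times>\<times> (additive_group :: 'f monoid) \<and>
            subgroup (mats2 l) GL_group \<and>
            G Mod C \<cong> GL_group\<lparr>carrier := mats2 l\<rparr>)"
  using aut_lei4_structure[OF assms(1,2)] mats_char2[of l] unfolding G_def C_def by simp

end
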